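(* Let $B$ be either $BF(2m+1,2n+1)$ with integers $m,n\ge 1$, or $BF(2m+1,2k)$ with integers $m\ge 1$, $k\ge 2$, or a graph obtained from one of these by adding chords inside its two cycles (that is, edges joining two non-adjacent vertices of the same cycle) in such a way that at least one vertex retains degree $2$. There is an algorithm which, given such a $B$ (with its labelled cycle structure) and a vertex $r$ of $OTIS(B)$, constructs two independent spanning trees of $OTIS(B)$ rooted at $r$, in time linear in the number of vertices of $OTIS(B)$.
   Context: All graphs are finite, simple and undirected. For integers $p,q\ge 3$, the (generalized) butterfly/bowtie graph $BF(p,q)$ is the graph consisting of two cycles $C_p$ and $C_q$ (on $p$ and $q$ vertices) sharing exactly one vertex, which is a cutvertex. Explicitly, its vertex set is $\{1,2,\dots,p+q-1\}$; with $c=p$, the vertices $1,2,\dots,c$ form in this cyclic order the cycle $C_p$, and the vertices $c,c+1,\dots,p+q-1$ form in this cyclic order the cycle $C_q$; there are no other edges. For a graph $G$, the graph $OTIS(G)$ has vertex set $\{\langle u,v\rangle : u,v\in V(G)\}$ and edge set $$\{(\langle v,u\rangle,\langle v,u'\rangle) : v\in V(G),\ (u,u')\in E(G)\}\ \cup\ \{(\langle v,u\rangle,\langle u,v\rangle) : u,v\in V(G),\ u\ne v\}.$$ Two spanning trees $T_1,T_2$ of a graph, rooted at the same vertex $r$, are independent if for every vertex $v\neq r$ the path from $r$ to $v$ in $T_1$ and the path from $r$ to $v$ in $T_2$ have no edge in common and no vertex in common other than $r$ and $v$. Running time is counted in elementary operations (unit-cost model), with an implied constant independent of $m,n,k$ and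 of the added chords. *)

theory Defs
  imports Main
begin

section \<open>Finite simple undirected graphs\<close>

(* Own definitions: the tree notion of the AFP entry Graph_Theory forbids directed cycles only,
   and so does not describe undirected trees. *)

record 'a ugraph =
  verts :: "'a set"
  edges :: "'a set set"

definition degree :: "'a ugraph \<Rightarrow> 'a \<Rightarrow> nat" where
  "degree G v = card {e \<in> edges G. v \<in> e}"

definition path :: "'a ugraph \<Rightarrow> 'a \<Rightarrow> 'a list \<Rightarrow> 'a \<Rightarrow> bool" where
  "path G u xs v \<longleftrightarrow>
     xs \<noteq> [] \<and> hd xs = u \<and> last xs = v \<and> distinct xs \<and> set xs \<subseteq> verts G \<and>
     successively (\<lambda>x y. {x, y} \<in> edges G) xs"

definition path_edges :: "'a list \<Rightarrow> 'a set set" where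
  "path_edges xs = {{xs ! i, xs ! Suc i} | i. Suc i < length xs}"

definition cycle :: "'a ugraph \<Rightarrow> 'a list \<Rightarrow> bool" where
  "cycle G xs \<longleftrightarrow>
     length xs \<ge> 3 \<and> distinct xs \<and> set xs \<subseteq> verts G \<and>
     successively (\<lambda>x y. {x, y} \<in> edges G) xs \<and> {last xs, hd xs} \<in> edges G"

definition connected :: "'a ugraph \<Rightarrow> bool" where
  "connected G \<longleftrightarrow>
     verts G \<noteq> {} \<and> (\<forall>u \<in> verts G. \<forall>v \<in> verts G. \<exists>xs. path G u xs v)"

definition tree :: "'a ugraph \<Rightarrow> bool" where
  "tree G \<longleftrightarrow> connected G \<and> (\<nexists>xs. cycle G xs)"

definition spanning_tree :: "'a ugraph \<Rightarrow> 'a ugraph \<Rightarrow> bool" where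
  "spanning_tree T G \<longleftrightarrow> verts T = verts G \<and> edges T \<subseteq> edges G \<and> tree T"

(* Meant for spanning trees of the same graph: the paths quantified over then exist uniquely. *)
definition independent :: "'a ugraph \<Rightarrow> 'a ugraph \<Rightarrow> 'a \<Rightarrow> bool" where
  "independent T1 T2 r \<longleftrightarrow>
     (\<forall>v \<in> verts T1 - {r}. \<forall>xs ys. path T1 r xs v \<and> path T2 r ys v \<longrightarrow>
        path_edges xs \<inter> path_edges ys = {} \<and> set xs \<inter> set ys = {r, v})"


section \<open>Butterfly graphs, chords, OTIS networks\<close>

definition BF :: "nat \<Rightarrow> nat \<Rightarrow> nat ugraph" where
  "BF p q =
     \<lparr>verts = {1..p + q - 1},
      edges = {{i, i + 1} | i. 1 \<le> i \<and> i < p} \<union> {{p, 1}} \<union>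
              {{i, i + 1} | i. p \<le> i \<and> i < p + q - 1} \<union> {{p + q - 1, p}}\<rparr>"

(* Two vertices of one of the cycles are adjacent in BF p q iff they are adjacent in that cycle. *)
definition chords :: "nat \<Rightarrow> nat \<Rightarrow> nat set set" where
  "chords p q =
     {{x, y} | x y. x \<noteq> y \<and> {x, y} \<notin> edges (BF p q) \<and>
        ({x, y} \<subseteq> {1..p} \<or> {x, y} \<subseteq> {p..p + q - 1})}"

definition add_edges :: "'a ugraph \<Rightarrow> 'a set set \<Rightarrow> 'a ugraph" where
  "add_edges G F = \<lparr>verts = verts G, edges = edges G \<union> F\<rparr>"

definition OTIS :: "'a ugraph \<Rightarrow> ('a \<times> 'a) ugraph" where
  "OTIS G =
     \<lparr>verts = verts G \<times> verts G,
      edges = {{(v, u), (v, u')} | v u u'. v \<in> verts G \<and> {u, u'} \<in> edges G} \<union>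
              {{(v, u), (u, v)} | u v. u \<in> verts G \<and> v \<in> verts G \<and> u \<noteq> v}\<rparr>"


section \<open>A unit-cost random access machine\<close>

text \<open>
  While programs over natural-number registers and finitely many arrays with indirect access.
  The only arithmetic is addition and truncated subtraction, and every operation, constant,
  register or array access costs one unit.
\<close>

record store =
  reg :: "nat \<Rightarrow> nat"
  arr :: "nat \<Rightarrow> nat \<Rightarrow> nat"

datatype aexp = Const nat | Reg nat | Elem nat aexp | Add aexp aexp | Sub aexp aexp

datatype bexp = Less aexp aexp | Equal aexp aexp | Negate bexp | Both bexp bexp

datatype com =
    Skip
  | Assign nat aexp
  | Store nat aexp aexp
  | Seq com com
  | Cond bexp com com
  | While bexp com

primrec aval :: "aexp \<Rightarrow> store \<Rightarrow> nat" where
  "aval (Const k) s = k"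
| "aval (Reg x) s = reg s x"
| "aval (Elem a e) s = arr s a (aval e s)"
| "aval (Add e1 e2) s = aval e1 s + aval e2 s"
| "aval (Sub e1 e2) s = aval e1 s - aval e2 s"

primrec bval :: "bexp \<Rightarrow> store \<Rightarrow> bool" where
  "bval (Less e1 e2) s \<longleftrightarrow> aval e1 s < aval e2 s"
| "bval (Equal e1 e2) s \<longleftrightarrow> aval e1 s = aval e2 s"
| "bval (Negate b) s \<longleftrightarrow> \<not> bval b s"
| "bval (Both b1 b2) s \<longleftrightarrow> bval b1 s \<and> bval b2 s"

primrec acost :: "aexp \<Rightarrow> nat" where
  "acost (Const k) = 1"
| "acost (Reg x) = 1"
| "acost (Elem a e) = acost e + 1"
| "acost (Add e1 e2) = acost e1 + acost e2 + 1"
| "acost (Sub e1 e2) = acost e1 + acost e2 + 1"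

primrec bcost :: "bexp \<Rightarrow> nat" where
  "bcost (Less e1 e2) = acost e1 + acost e2 + 1"
| "bcost (Equal e1 e2) = acost e1 + acost e2 + 1"
| "bcost (Negate b) = bcost b + 1"
| "bcost (Both b1 b2) = bcost b1 + bcost b2 + 1"

(* exec c s t s': started in s, c terminates after t steps in s'. *)
inductive exec :: "com \<Rightarrow> store \<Rightarrow> nat \<Rightarrow> store \<Rightarrow> bool" where
  Skip: "exec Skip s 1 s"
| Assign: "exec (Assign x e) s (acost e + 1) (s\<lparr>reg := (reg s)(x := aval e s)\<rparr>)"
| Store: "exec (Store a i e) s (acost i + acost e + 1)
            (s\<lparr>arr := (arr s)(a := (arr s a)(aval i s := aval e s))\<rparr>)"
| Seq: "exec c1 s t1 s' \<Longrightarrow> exec c2 s' t2 s'' \<Longrightarrow> exec (Seq c1 c2) s (t1 + t2) s''"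
| CondTrue: "bval b s \<Longrightarrow> exec c1 s t s' \<Longrightarrow> exec (Cond b c1 c2) s (bcost b + t + 1) s'"
| CondFalse: "\<not> bval b s \<Longrightarrow> exec c2 s t s' \<Longrightarrow> exec (Cond b c1 c2) s (bcost b + t + 1) s'"
| WhileFalse: "\<not> bval b s \<Longrightarrow> exec (While b c) s (bcost b + 1) s"
| WhileTrue: "bval b s \<Longrightarrow> exec c s t1 s' \<Longrightarrow> exec (While b c) s' t2 s'' \<Longrightarrow>
    exec (While b c) s (bcost b + t1 + t2 + 1) s''"

inductive_cases SkipE: "exec Skip s t s'"
inductive_cases AssignE: "exec (Assign x e) s t s'"
inductive_cases StoreE: "exec (Store a i e) s t s'"
inductive_cases SeqE: "exec (Seq c1 c2) s t s'"
inductive_cases CondE: "exec (Cond b c1 c2) s t s'"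
inductive_cases WhileE: "exec (While b c) s t s'"

lemma exec_deterministic:
  "exec c s t s' \<Longrightarrow> exec c s u s'' \<Longrightarrow> u = t \<and> s'' = s'"
proof (induction arbitrary: u s'' rule: exec.induct)
  case Skip then show ?case by (rule SkipE) simp
next
  case Assign then show ?case by (rule AssignE) simp
next
  case Store then show ?case by (rule StoreE) simp
next
  case Seq from Seq.prems show ?case by (rule SeqE) (metis Seq.IH)
next
  case CondTrue from CondTrue.prems show ?case
    by (rule CondE) (use CondTrue.hyps(1) in \<open>auto dest!: CondTrue.IH\<close>)
next
  case CondFalse from CondFalse.prems show ?case
    by (rule CondE) (use CondFalse.hyps(1) in \<open>auto dest!: CondFalse.IH\<close>)
next
  case WhileFalse from WhileFalse.prems show ?case
    by (rule WhileE) (use WhileFalse.hyps in simp_all)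
next
  case WhileTrue from WhileTrue.prems show ?case
    by (rule WhileE) (use WhileTrue.hyps(1) in \<open>auto dest!: WhileTrue.IH\<close>)
qed


section \<open>Input and output of the algorithm\<close>

(* The chords are handed over in any order and with either orientation, without repetition. *)
definition chord_list :: "(nat \<times> nat) list \<Rightarrow> nat set set \<Rightarrow> bool" where
  "chord_list cs F \<longleftrightarrow>
     distinct (map (\<lambda>(x, y). {x, y}) cs) \<and> set (map (\<lambda>(x, y). {x, y}) cs) = F"

(* Registers 0 and 1 hold the cycle lengths, 2 and 3 the root, 4 the number of chords;
   arrays 0 and 1 hold the end points of the chords; everything else is 0. *)
definition input :: "nat \<Rightarrow> nat \<Rightarrow> (nat \<times> nat) list \<Rightarrow> nat \<times> nat \<Rightarrow> store" where
  "input p q cs r =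
     \<lparr>reg = (\<lambda>_. 0)(0 := p, 1 := q, 2 := fst r, 3 := snd r, 4 := length cs),
      arr = (\<lambda>_ _. 0)(0 := (\<lambda>i. if i < length cs then fst (cs ! i) else 0),
                      1 := (\<lambda>i. if i < length cs then snd (cs ! i) else 0))\<rparr>"

(* A tree on V rooted at r is output by the parents of the vertices other than r. The two
   components of the parent of (u, v) are read from arrays a and b at index u * n + v, which
   is injective on {1..n} x {1..n}. *)
definition output_tree ::
    "store \<Rightarrow> nat \<Rightarrow> nat \<Rightarrow> nat \<Rightarrow> (nat \<times> nat) set \<Rightarrow> nat \<times> nat \<Rightarrow> (nat \<times> nat) ugraph" where
  "output_tree s a b n V r =
     \<lparr>verts = V,
      edges = {{(u, v), (arr s a (u * n + v), arr s b (u * n + v))} | u v. (u, v) \<in> V - {r}}\<rparr>"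

definition constructs_trees :: "store \<Rightarrow> nat ugraph \<Rightarrow> nat \<times> nat \<Rightarrow> bool" where
  "constructs_trees s B r \<longleftrightarrow>
     (let G = OTIS B; n = card (verts B);
          T1 = output_tree s 2 3 n (verts G) r;
          T2 = output_tree s 4 5 n (verts G) r
      in spanning_tree T1 G \<and> spanning_tree T2 G \<and> independent T1 T2 r)"

end

(* Suppose the vertices are ordered so that every vertex other than the root has a neighbour that
   is smaller or the root, and another neighbour that is larger or the root. Then the smaller
   neighbours are the parents of one tree and the larger ones those of another, and the two trees
   are independent.

   Let n = p + q - 1. In OTIS(BF(p,q)) order the vertices (v, u) lexicographically. Inside a group
   v with 1 < v < n the neighbours of (v, u) are (v, u - 1) and (v, u + 1), and at the two ends the
   swap edges lead to (1, v) and (n, v). The vertices of the groups 1 and n are supplied from the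
   other side by swap edges, and their cycles permit reordering these two groups so that the only
   extreme vertices are the adjacent vertices (1, n) and (n, 1).

   To move the root to a vertex r of a group a with 1 < a < n, follow an increasing path from r to
   (n, 1) and a decreasing one from r to (1, n). The first path becomes the bottom of the new order,
   the second one its top, and the order of all other vertices is reversed between them. The parents
   then depend on a only. If r lies in group 1 or n, reflecting the left or the right cycle moves it
   to a group in between. *)

theory Submission
  imports Defs "HOL-Library.Product_Lexorder"
begin

section \<open>Trees given by parent functions\<close>

definition parent_tree :: "'a set \<Rightarrow> 'a \<Rightarrow> ('a \<Rightarrow> 'a) \<Rightarrow> 'a ugraph" where
  "parent_tree V r f = \<lparr>verts = V, edges = {{v, f v} | v. v \<in> V - {r}}\<rparr>"

lemma path_extend:
  assumes "path G u xs v" "{v, w} \<in> edges G" "w \<in> verts G"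
  shows "\<exists>ys. path G u ys w"
proof (cases "w \<in> set xs")
  case True
  then obtain as bs where xs: "xs = as @ w # bs" by (meson split_list)
  have "path G u (as @ [w]) w"
    using assms(1) unfolding path_def xs
    by (auto simp: successively_append_iff hd_append split: if_splits)
  then show ?thesis by blast
next
  case False
  then have "path G u (xs @ [w]) w"
    using assms unfolding path_def by (auto simp: successively_append_iff)
  then show ?thesis by blast
qed

lemma path_if_rtrancl:
  assumes "(u, v) \<in> {(x, y). {x, y} \<in> edges G \<and> y \<in> verts G}\<^sup>*" "u \<in> verts G"
  shows "\<exists>xs. path G u xs v"
  using assms(1)
proof (induction rule: rtrancl_induct)
  case base
  have "path G u [u] u" using assms(2) by (simp add: path_def)
  then show ?case by blast
next
  case step
  then show ?case using path_extend by fastforce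
qed

text \<open>\<open>h\<close> is a termination measure: iterating \<open>f\<close> from any vertex
  ends in \<open>r\<close>.\<close>

locale parent_function =
  fixes V :: "'a set" and r :: 'a and f :: "'a \<Rightarrow> 'a" and h :: "'a \<Rightarrow> nat"
  assumes root: "r \<in> V"
    and closed: "v \<in> V - {r} \<Longrightarrow> f v \<in> V"
    and decreasing: "v \<in> V - {r} \<Longrightarrow> h (f v) < h v"
begin

abbreviation "T \<equiv> parent_tree V r f"

lemma verts_T [simp]: "verts T = V"
  by (simp add: parent_tree_def)

lemma edge_cases:
  assumes "{x, y} \<in> edges T"
  shows "x \<in> V - {r} \<and> y = f x \<or> y \<in> V - {r} \<and> x = f y"
  using assms by (auto simp: parent_tree_def doubleton_eq_iff)

lemma connected_T: "connected T"
proof -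
  let ?R = "{(x, y). {x, y} \<in> edges T \<and> y \<in> verts T}"
  have sub: "(v, r) \<in> ?R\<^sup>* \<and> (r, v) \<in> ?R\<^sup>*" if "v \<in> V" for v
    using that
  proof (induction "h v" arbitrary: v rule: less_induct)
    case less
    show ?case
    proof (cases "v = r")
      case False
      have e: "{v, f v} \<in> edges T"
        using False less.prems by (auto simp: parent_tree_def)
      have "(v, f v) \<in> ?R" "(f v, v) \<in> ?R"
        using e False less.prems closed[of v] by (auto simp: insert_commute)
      moreover have "(f v, r) \<in> ?R\<^sup>* \<and> (r, f v) \<in> ?R\<^sup>*"
        using less.hyps[of "f v"] closed[of v] decreasing[of v] less.prems False by auto
      ultimately show ?thesis
        by (meson converse_rtrancl_into_rtrancl rtrancl_into_rtrancl)
    qed simp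
  qed
  have "\<exists>xs. path T u xs v" if "u \<in> V" "v \<in> V" for u v
  proof (rule path_if_rtrancl)
    show "(u, v) \<in> ?R\<^sup>*"
      using sub[OF that(1)] sub[OF that(2)] by (blast intro: rtrancl_trans)
  qed (use that in simp)
  then show ?thesis
    using root by (auto simp: connected_def)
qed

text \<open>A vertex with maximal \<open>h\<close> on a cycle would have its parent on both sides,
  although its two neighbours on the cycle differ.\<close>

lemma acyclic_T: "\<not> cycle T xs"
proof
  assume cyc: "cycle T xs"
  define l where "l = length xs"
  have l: "l \<ge> 3" and d: "distinct xs" and suc: "successively (\<lambda>x y. {x, y} \<in> edges T) xs"
    and closing: "{last xs, hd xs} \<in> edges T"
    using cyc by (auto simp: cycle_def l_def)
  have e: "{xs ! i, xs ! (Suc i mod l)} \<in> edges T" if "i < l" for i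
  proof (cases "Suc i = l")
    case True
    then have "i = l - 1" by simp
    moreover have "xs \<noteq> []" using l by (auto simp: l_def)
    ultimately show ?thesis
      using closing True by (simp add: last_conv_nth hd_conv_nth l_def)
  next
    case False
    then show ?thesis
      using suc that by (simp add: successively_conv_nth l_def)
  qed
  obtain i where i: "i < l" and max: "\<And>j. j < l \<Longrightarrow> h (xs ! j) \<le> h (xs ! i)"
  proof -
    let ?M = "(\<lambda>j. h (xs ! j)) ` {..<l}"
    have "Max ?M \<in> ?M" using l by (intro Max_in) (auto simp: lessThan_empty_iff)
    then obtain i where "i < l" "Max ?M = h (xs ! i)" by auto
    moreover have "h (xs ! j) \<le> Max ?M" if "j < l" for j
      using that by (intro Max_ge) auto
    ultimately show ?thesis using that by metis
  qed
  \<comment> \<open>The cyclic predecessor of \<open>i\<close>; since \<open>l\<close> is at least 3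
    it differs from the successor.\<close>
  define k where "k = (if i = 0 then l - 1 else i - 1)"
  have k: "k < l" "Suc k mod l = i" using i l by (auto simp: k_def)
  have kj: "k \<noteq> Suc i mod l"
    using i l by (cases "Suc i = l") (auto simp: k_def)
  have par: "y = f (xs ! i)" if "{xs ! i, y} \<in> edges T" "h y \<le> h (xs ! i)" for y
    using edge_cases[OF that(1)] that(2) decreasing[of y] by auto
  have "xs ! (Suc i mod l) = f (xs ! i)"
    using par e[OF i] max[of "Suc i mod l"] l by simp
  moreover have "xs ! k = f (xs ! i)"
    using par e[OF k(1)] max[OF k(1)] k by (simp add: insert_commute)
  ultimately have "xs ! k = xs ! (Suc i mod l)" by simp
  moreover have "Suc i mod l < l" using l by simp
  ultimately show False
    using kj k(1) d by (simp add: nth_eq_iff_index_eq l_def)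
qed

lemma spanning_tree_T:
  assumes "verts G = V" and "\<And>v. v \<in> V - {r} \<Longrightarrow> {v, f v} \<in> edges G"
  shows "spanning_tree T G"
  using assms connected_T acyclic_T by (auto simp: spanning_tree_def tree_def parent_tree_def)

text \<open>The first edge cannot lead from \<open>r\<close> to a parent. A later step to a parent
  would return to the preceding vertex, against distinctness.\<close>

lemma path_from_root:
  assumes "path T r xs v"
  shows "Suc i < length xs \<Longrightarrow> xs ! Suc i \<in> V - {r} \<and> f (xs ! Suc i) = xs ! i"
proof (induction i)
  case 0
  have "{xs ! 0, xs ! 1} \<in> edges T" "xs ! 0 = r"
    using assms 0 by (auto simp: path_def successively_conv_nth hd_conv_nth)
  then show ?case using edge_cases[of "xs ! 0" "xs ! 1"] by auto
next
  case (Suc i)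
  have e: "{xs ! Suc i, xs ! Suc (Suc i)} \<in> edges T" and d: "distinct xs"
    using assms Suc.prems by (auto simp: path_def successively_conv_nth)
  have "xs ! Suc (Suc i) \<noteq> xs ! i"
    using d Suc.prems by (simp add: nth_eq_iff_index_eq)
  then show ?case using edge_cases[OF e] Suc by auto
qed

text \<open>A general transitive \<open>R\<close> serves both trees: it is \<open><\<close> on ranks
  for one and \<open>>\<close> for the other.\<close>

lemma path_vertices:
  assumes "path T r xs v" and "transp R"
    and R: "\<And>w. w \<in> V - {r} \<Longrightarrow> f w = r \<or> R (f w) w"
    and w: "w \<in> set xs"
  shows "w = r \<or> w = v \<or> R w v"
proof -
  obtain i where i: "i < length xs" "w = xs ! i" using w by (auto simp: in_set_conv_nth)
  have r: "xs ! 0 = r" and v: "v = xs ! (length xs - 1)" and d: "distinct xs"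
    using assms(1) by (auto simp: path_def hd_conv_nth last_conv_nth)
  have "xs ! j = r \<or> j = k \<or> R (xs ! j) (xs ! k)" if "j \<le> k" "k < length xs" for j k
    using that
  proof (induction k)
    case (Suc k)
    show ?case
    proof (cases "j = Suc k")
      case False
      then have jk: "j \<le> k" and IH: "xs ! j = r \<or> j = k \<or> R (xs ! j) (xs ! k)"
        using Suc by auto
      have *: "xs ! k = r \<or> R (xs ! k) (xs ! Suc k)"
        using path_from_root[OF assms(1) Suc.prems(2)] R[of "xs ! Suc k"] by auto
      \<comment> \<open>The root occurs at index 0 only, so only the first step may lack the
        comparison by \<open>R\<close>.\<close>
      have "k = 0" if "xs ! k = r"
        using d r that Suc.prems(2) by (metis Suc_lessD gr_zeroI nth_eq_iff_index_eq order_less_trans)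
      then show ?thesis
        using jk IH * r \<open>transp R\<close> by (metis le_zero_eq transpD)
    qed simp
  qed simp
  moreover have "i \<le> length xs - 1" "length xs - 1 < length xs" using i by auto
  ultimately have "w = r \<or> i = length xs - 1 \<or> R w v" using i(2) v by metis
  then show ?thesis using i(2) v by blast
qed

end

text \<open>Along the first tree the rank falls towards the root and along the second it grows, with the
  root itself exempt: it plays both the least and the greatest vertex.\<close>

lemma independent_trees_by_rank:
  fixes rank :: "'a \<Rightarrow> 'b::linorder"
  assumes V: "finite V" "r \<in> V" "verts G = V"
    and f: "\<And>v. v \<in> V - {r} \<Longrightarrow> f v \<in> V" "\<And>v. v \<in> V - {r} \<Longrightarrow> {v, f v} \<in> edges G"
      "\<And>v. v \<in> V - {r} \<Longrightarrow> f v = r \<or> rank (f v) < rank v"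
    and g: "\<And>v. v \<in> V - {r} \<Longrightarrow> g v \<in> V" "\<And>v. v \<in> V - {r} \<Longrightarrow> {v, g v} \<in> edges G"
      "\<And>v. v \<in> V - {r} \<Longrightarrow> g v = r \<or> rank v < rank (g v)"
    and distinct: "\<And>v. v \<in> V - {r} \<Longrightarrow> f v \<noteq> g v"
  shows "spanning_tree (parent_tree V r f) G"
    and "spanning_tree (parent_tree V r g) G"
    and "independent (parent_tree V r f) (parent_tree V r g) r"
proof -
  \<comment> \<open>Counting the vertices of smaller rank turns the rank into a natural number. The
    root gets 0, and \<open>Suc\<close> keeps all others above it, whatever the rank of the
    root.\<close>
  interpret F: parent_function V r f
    "\<lambda>v. if v = r then 0 else Suc (card {w \<in> V. rank w < rank v})"
  proof unfold_locales
    fix v assume v: "v \<in> V - {r}"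
    have "card {w \<in> V. rank w < rank (f v)} < card {w \<in> V. rank w < rank v}" if "f v \<noteq> r"
      using V(1) f(1,3)[OF v] that by (intro psubset_card_mono) auto
    then show "(if f v = r then 0 else Suc (card {w \<in> V. rank w < rank (f v)}))
        < (if v = r then 0 else Suc (card {w \<in> V. rank w < rank v}))"
      using v by auto
  qed (use V f in auto)
  interpret G: parent_function V r g
    "\<lambda>v. if v = r then 0 else Suc (card {w \<in> V. rank v < rank w})"
  proof unfold_locales
    fix v assume v: "v \<in> V - {r}"
    have "card {w \<in> V. rank (g v) < rank w} < card {w \<in> V. rank v < rank w}" if "g v \<noteq> r"
      using V(1) g(1,3)[OF v] that by (intro psubset_card_mono) auto
    then show "(if g v = r then 0 else Suc (card {w \<in> V. rank (g v) < rank w}))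
        < (if v = r then 0 else Suc (card {w \<in> V. rank v < rank w}))"
      using v by auto
  qed (use V g in auto)
  show "spanning_tree (parent_tree V r f) G" by (rule F.spanning_tree_T) (use V f in auto)
  show "spanning_tree (parent_tree V r g) G" by (rule G.spanning_tree_T) (use V g in auto)
  show "independent (parent_tree V r f) (parent_tree V r g) r"
    unfolding independent_def
  proof (intro ballI allI impI, elim conjE)
    fix v xs ys
    assume v: "v \<in> verts F.T - {r}" and xs: "path F.T r xs v" and ys: "path G.T r ys v"
    have rv: "r \<in> set xs" "v \<in> set xs" "r \<in> set ys" "v \<in> set ys"
      using xs ys by (metis path_def hd_in_set last_in_set)+
    have "w = r \<or> w = v \<or> rank w < rank v" if "w \<in> set xs" for w
      using F.path_vertices[OF xs, of "\<lambda>x y. rank x < rank y" w] f(3) that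
      by (simp add: transp_on_def less_trans)
    moreover have "w = r \<or> w = v \<or> rank w > rank v" if "w \<in> set ys" for w
      using G.path_vertices[OF ys, of "\<lambda>x y. rank x > rank y" w] g(3) that
      by (simp add: transp_on_def) (meson less_trans)
    \<comment> \<open>Apart from the ends, one path stays below \<open>rank v\<close> and the other
      above it.\<close>
    ultimately have inter: "set xs \<inter> set ys = {r, v}"
      using rv by fastforce
    \<comment> \<open>A common edge would have to join \<open>r\<close> and \<open>v\<close>, making
      \<open>r\<close> both parents of \<open>v\<close>; the assumption \<open>distinct\<close>
      excludes this.\<close>
    have "False" if ex: "e \<in> path_edges xs" and ey: "e \<in> path_edges ys" for e
    proof -
      obtain i where i: "Suc i < length xs" "e = {xs ! i, xs ! Suc i}"
        using ex by (auto simp: path_edges_def)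
      obtain j where j: "Suc j < length ys" "e = {ys ! j, ys ! Suc j}"
        using ey by (auto simp: path_edges_def)
      have "e \<subseteq> {r, v}"
        using i j inter
        by (smt (verit) Int_iff Suc_lessD insert_iff nth_mem singletonD subsetI)
      then have "xs ! i \<in> {r, v}" "xs ! Suc i \<in> {r, v}" "ys ! j \<in> {r, v}" "ys ! Suc j \<in> {r, v}"
        using i j by auto
      moreover have "xs ! i \<noteq> xs ! Suc i" "ys ! j \<noteq> ys ! Suc j"
        using xs ys i j by (auto simp: path_def nth_eq_iff_index_eq)
      ultimately have "f v = r" "g v = r"
        using F.path_from_root[OF xs i(1)] G.path_from_root[OF ys j(1)] by auto
      then show False using distinct[of v] v by simp
    qed
    then show "path_edges xs \<inter> path_edges ys = {} \<and> set xs \<inter> set ys = {r, v}"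
      using inter by blast
  qed
qed


section \<open>The two parents of a vertex\<close>

text \<open>The first pair is the parent in the tree of falling \<open>rank\<close>, the second in
  that of growing \<open>rank\<close>, for a root in group \<open>a\<close> with
  \<open>1 < a < n\<close>. At \<open>(1, 1)\<close> the two are exchanged if \<open>a = 2\<close>,
  because \<open>(1, 2)\<close> then lies on the top path; likewise at \<open>(n, n)\<close> if
  \<open>a + 1 = n\<close>, where \<open>(n, n - 1)\<close> lies on the bottom path.\<close>

definition parents :: "nat \<Rightarrow> nat \<Rightarrow> nat \<Rightarrow> nat \<Rightarrow> nat \<Rightarrow> (nat \<times> nat) \<times> (nat \<times> nat)" where
  "parents p n a x y =
    (if x = 1 \<and> y = 1 \<and> a = 2 then ((1, p), (1, 2))
     else if x = 1 \<and> y = 1 then ((1, 2), (1, p))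
     else if x = 1 \<and> y < a then ((y, 1), (1, y + 1))
     else if x = 1 \<and> y = a then ((1, y + 1), (y, 1))
     else if x = 1 \<and> y < n then ((1, y + 1), (1, y - 1))
     else if x = 1 then ((n, 1), (1, n - 1))
     else if x = n \<and> y = n \<and> a + 1 = n then ((n, n - 1), (n, p))
     else if x = n \<and> y = n then ((n, p), (n, n - 1))
     else if x = n \<and> a < y then ((n, y - 1), (y, n))
     else if x = n \<and> y = a then ((y, n), (n, y - 1))
     else if x = n \<and> 1 < y then ((n, y + 1), (n, y - 1))
     else if x = n then ((n, 2), (1, n))
     else if x = a \<and> y = 1 then ((1, x), (x, 2))
     else if x = a \<and> y < n then ((x, y - 1), (x, y + 1))
     else if x = a then ((x, n - 1), (n, x))
     else if y = 1 then ((x, 2), (1, x))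
     else if y < n then ((x, y + 1), (x, y - 1))
     else ((n, x), (x, n - 1)))"

text \<open>The position orders group 1 as \<open>n, n - 1, \<dots>, 3, 1, 2\<close> and group \<open>n\<close> as
  \<open>n - 1, n, n - 2, \<dots>, 1\<close>: the diagonal vertices \<open>(1, 1)\<close> and \<open>(n, n)\<close> have no swap edge and
  need a neighbour on either side within their own group.\<close>

definition position :: "nat \<Rightarrow> nat \<Rightarrow> nat \<Rightarrow> int" where
  "position n x y =
    (if x = 1 then if y = 1 then - 5 else - 2 * int y
     else if x = n then if y = n then 3 - 2 * int n else - 2 * int y
     else int y)"

text \<open>The first component separates the bottom path, the reversed middle part and the top path.
  If the bottom path contains both neighbours of \<open>(n, n)\<close> in its group, then \<open>(n, n)\<close> is
  inserted between them; likewise for \<open>(1, 1)\<close> and the top path.\<close>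

definition rank :: "nat \<Rightarrow> nat \<Rightarrow> nat \<Rightarrow> nat \<times> nat \<Rightarrow> nat \<times> int \<times> int" where
  "rank n a b = (\<lambda>(x, y).
    if x = a \<and> b < y \<or> x = n \<and> y \<le> a \<or> x = n \<and> y = n \<and> a + 1 = n
    then (0, int x, position n x y)
    else if x = a \<and> y < b \<or> x = 1 \<and> a \<le> y \<or> x = 1 \<and> y = 1 \<and> a = 2
    then (2, int x, position n x y)
    else (1, - int x, - position n x y))"

section \<open>Adjacency in \<open>BF p q\<close> and its OTIS network\<close>

lemma BF_edge_iff:
  assumes "n = p + q - 1" "3 \<le> p" "3 \<le> q"
  shows "{x, y} \<in> edges (BF p q) \<longleftrightarrow> x \<in> {1..n} \<and> y \<in> {1..n} \<and>
    (y = x + 1 \<or> x = y + 1 \<or> x = 1 \<and> y = p \<or> x = p \<and> y = 1 \<or> x = n \<and> y = p \<or> x = p \<and> y = n)"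
proof -
  have step: "{x, y} \<in> {{i, i + 1} | i. l \<le> i \<and> i < u} \<longleftrightarrow>
      y = x + 1 \<and> l \<le> x \<and> x < u \<or> x = y + 1 \<and> l \<le> y \<and> y < u" for l u
    by (auto simp: doubleton_eq_iff)
  have E: "{x, y} \<in> edges (BF p q) \<longleftrightarrow> (y = x + 1 \<and> 1 \<le> x \<and> x < p \<or> x = y + 1 \<and> 1 \<le> y \<and> y < p) \<or>
      (x = p \<and> y = 1 \<or> x = 1 \<and> y = p) \<or>
      (y = x + 1 \<and> p \<le> x \<and> x < n \<or> x = y + 1 \<and> p \<le> y \<and> y < n) \<or>
      (x = n \<and> y = p \<or> x = p \<and> y = n)"
    unfolding BF_def ugraph.simps Un_iff step singleton_iff doubleton_eq_iff assms(1) by blast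
  have pn: "3 \<le> p" "p + 2 \<le> n" using assms by auto
  \<comment> \<open>The two runs of consecutive labels share the cutvertex \<open>p\<close> and
    merge into one; only the closing edges remain separate.\<close>
  show ?thesis
    unfolding E
    by (rule iffI; elim disjE conjE; use pn in \<open>cases "x < p"; cases "y < p"; auto\<close>)
qed

lemma OTIS_edge_iff:
  "{(x, y), (x', y')} \<in> edges (OTIS G) \<longleftrightarrow>
    x = x' \<and> x \<in> verts G \<and> {y, y'} \<in> edges G \<or>
    x' = y \<and> y' = x \<and> x \<noteq> y \<and> x \<in> verts G \<and> y \<in> verts G"
  by (auto simp: OTIS_def doubleton_eq_iff insert_commute)

lemma OTIS_BF_edgeI:
  assumes "n = p + q - 1" "3 \<le> p" "3 \<le> q" "x \<in> {1..n}" "y \<in> {1..n}" "x' \<in> {1..n}" "y' \<in> {1..n}"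
    and "x = x' \<and> (y' = y + 1 \<or> y = y' + 1 \<or> y = 1 \<and> y' = p \<or> y = p \<and> y' = 1
          \<or> y = n \<and> y' = p \<or> y = p \<and> y' = n) \<or> x' = y \<and> y' = x \<and> x \<noteq> y"
  shows "{(x, y), (x', y')} \<in> edges (OTIS (BF p q))"
proof -
  have "verts (BF p q) = {1..n}" using assms(1) by (simp add: BF_def)
  then show ?thesis
    using assms(4-8) unfolding OTIS_edge_iff BF_edge_iff[OF assms(1-3)] by blast
qed

section \<open>Adjacency and rank of the parents\<close>

locale butterfly =
  fixes p q n :: nat
  assumes n: "n = p + q - 1" and p: "3 \<le> p" and q: "3 \<le> q"
begin

lemma pn: "p + 2 \<le> n" using n q by simp

context
  fixes a b x y :: nat
  assumes a: "2 \<le> a" "a < n" and b: "b \<in> {1..n}"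
    and x: "x \<in> {1..n}" and y: "y \<in> {1..n}" and nonroot: "(x, y) \<noteq> (a, b)"
begin

text \<open>One goal per branch of \<open>parents\<close>, with the failed earlier tests already
  turned into bounds on the coordinates. The properties of the parents below then reduce to
  arithmetic.\<close>

lemma parents_cases:
  assumes
    "\<lbrakk>x = 1; y = 1; a = 2\<rbrakk> \<Longrightarrow> P ((1, p), (1, 2))"
    and "\<lbrakk>x = 1; y = 1; 2 < a\<rbrakk> \<Longrightarrow> P ((1, 2), (1, p))"
    and "\<lbrakk>x = 1; 1 < y; y < a\<rbrakk> \<Longrightarrow> P ((y, 1), (1, y + 1))"
    and "\<lbrakk>x = 1; y = a\<rbrakk> \<Longrightarrow> P ((1, y + 1), (y, 1))"
    and "\<lbrakk>x = 1; a < y; y < n\<rbrakk> \<Longrightarrow> P ((1, y + 1), (1, y - 1))"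
    and "\<lbrakk>x = 1; y = n\<rbrakk> \<Longrightarrow> P ((n, 1), (1, n - 1))"
    and "\<lbrakk>x = n; y = n; a + 1 = n\<rbrakk> \<Longrightarrow> P ((n, n - 1), (n, p))"
    and "\<lbrakk>x = n; y = n; a + 1 < n\<rbrakk> \<Longrightarrow> P ((n, p), (n, n - 1))"
    and "\<lbrakk>x = n; a < y; y < n\<rbrakk> \<Longrightarrow> P ((n, y - 1), (y, n))"
    and "\<lbrakk>x = n; y = a\<rbrakk> \<Longrightarrow> P ((y, n), (n, y - 1))"
    and "\<lbrakk>x = n; 1 < y; y < a\<rbrakk> \<Longrightarrow> P ((n, y + 1), (n, y - 1))"
    and "\<lbrakk>x = n; y = 1\<rbrakk> \<Longrightarrow> P ((n, 2), (1, n))"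
    and "\<lbrakk>x = a; y = 1\<rbrakk> \<Longrightarrow> P ((1, x), (x, 2))"
    and "\<lbrakk>x = a; 1 < y; y < n\<rbrakk> \<Longrightarrow> P ((x, y - 1), (x, y + 1))"
    and "\<lbrakk>x = a; y = n\<rbrakk> \<Longrightarrow> P ((x, n - 1), (n, x))"
    and "\<lbrakk>1 < x; x < n; x \<noteq> a; y = 1\<rbrakk> \<Longrightarrow> P ((x, 2), (1, x))"
    and "\<lbrakk>1 < x; x < n; x \<noteq> a; 1 < y; y < n\<rbrakk> \<Longrightarrow> P ((x, y + 1), (x, y - 1))"
    and "\<lbrakk>1 < x; x < n; x \<noteq> a; y = n\<rbrakk> \<Longrightarrow> P ((n, x), (x, n - 1))"
  shows "P (parents p n a x y)"
proof -
  have if_intro: "P (if c then u else w)" if "c \<Longrightarrow> P u" "\<not> c \<Longrightarrow> P w" for c u w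
    using that by simp
  show ?thesis
    unfolding parents_def
    apply (rule if_intro, (rule assms(1); use a x y in auto))
    apply (rule if_intro, (rule assms(2); use a x y in auto))
    apply (rule if_intro, (rule assms(3); use a x y in auto))
    apply (rule if_intro, (rule assms(4); use a x y in auto))
    apply (rule if_intro, (rule assms(5); use a x y in auto))
    apply (rule if_intro, (rule assms(6); use a x y in auto))
    apply (rule if_intro, (rule assms(7); use a x y in auto))
    apply (rule if_intro, (rule assms(8); use a x y in auto))
    apply (rule if_intro, (rule assms(9); use a x y in auto))
    apply (rule if_intro, (rule assms(10); use a x y in auto))
    apply (rule if_intro, (rule assms(11); use a x y in auto))
    apply (rule if_intro, (rule assms(12); use a x y in auto))
    apply (rule if_intro, (rule assms(13); use a x y in auto))
    apply (rule if_intro, (rule assms(14); use a x y in auto))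
    apply (rule if_intro, (rule assms(15); use a x y in auto))
    apply (rule if_intro, (rule assms(16); use a x y in auto))
    apply (rule if_intro, (rule assms(17); use a x y in auto))
    apply (rule assms(18); use a x y in auto)
    done
qed

lemma parents_closed:
  "fst (parents p n a x y) \<in> {1..n} \<times> {1..n} \<and> snd (parents p n a x y) \<in> {1..n} \<times> {1..n}"
  by (rule parents_cases) (use a x y p pn in auto)

lemma parents_distinct: "fst (parents p n a x y) \<noteq> snd (parents p n a x y)"
  by (rule parents_cases) (use a x y p pn in auto)

lemma parents_adjacent:
  "{(x, y), fst (parents p n a x y)} \<in> edges (OTIS (BF p q)) \<and>
   {(x, y), snd (parents p n a x y)} \<in> edges (OTIS (BF p q))"
  by (rule parents_cases; unfold fst_conv snd_conv; intro conjI OTIS_BF_edgeI[OF n p q x y])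
    (use a x y p pn in auto)

text \<open>A swap edge changes the group, so the first two components of \<open>rank\<close>
  decide. Within a group and region \<open>position\<close> decides: its odd values
  \<open>- 5\<close> and \<open>3 - 2 * int n\<close> lie strictly between the even ones of
  \<open>(1, 2)\<close> and \<open>(1, 3)\<close>, and of \<open>(n, n - 1)\<close> and
  \<open>(n, n - 2)\<close>.\<close>

lemma rank_fst_parents:
  "fst (parents p n a x y) = (a, b) \<or> rank n a b (fst (parents p n a x y)) < rank n a b (x, y)"
  by (rule parents_cases; use a b x y p pn nonroot in \<open>auto simp: rank_def position_def\<close>)

lemma rank_snd_parents:
  "snd (parents p n a x y) = (a, b) \<or> rank n a b (x, y) < rank n a b (snd (parents p n a x y))"
  by (rule parents_cases; use a b x y p pn nonroot in \<open>auto simp: rank_def position_def\<close>)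

end

end

section \<open>Reflecting a cycle\<close>

text \<open>For \<open>n = p + q - 1\<close> and \<open>a\<close> in \<open>{1..n}\<close>, an
  involutive automorphism of \<open>BF p q\<close> fixing the cutvertex \<open>p\<close>. It moves
  an extreme root group inwards: 1 goes to \<open>p - 1\<close>, and \<open>n\<close> to
  \<open>p + 1\<close>.\<close>

definition reflect :: "nat \<Rightarrow> nat \<Rightarrow> nat \<Rightarrow> nat \<Rightarrow> nat" where
  "reflect p n a i =
    (if a = 1 \<and> i < p then p - i else if a = n \<and> p < i then n + p + 1 - i else i)"

lemma reflect_range:
  assumes "3 \<le> p" "p + 2 \<le> n" "i \<in> {1..n}"
  shows "reflect p n a i \<in> {1..n}"
  using assms by (auto simp: reflect_def)

lemma reflect_reflect:
  assumes "3 \<le> p" "p + 2 \<le> n" "i \<in> {1..n}"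
  shows "reflect p n a (reflect p n a i) = i"
  using assms by (auto simp: reflect_def)

lemma reflect_root:
  assumes "3 \<le> p" "p + 2 \<le> n" "a \<in> {1..n}"
  shows "2 \<le> reflect p n a a" "reflect p n a a < n"
  using assms by (auto simp: reflect_def)

text \<open>Reversing a cycle reverses its consecutive pairs, but exchanges the closing edge with
  the other edge of that cycle at \<open>p\<close>.\<close>

lemma reflect_BF_edge:
  assumes n: "n = p + q - 1" and p: "3 \<le> p" and q: "3 \<le> q" and a: "a \<in> {1..n}"
    and edge: "{y, y'} \<in> edges (BF p q)"
  shows "{reflect p n a y, reflect p n a y'} \<in> edges (BF p q)"
proof -
  let ?\<sigma> = "reflect p n a"
  have pn: "p + 2 \<le> n" using n q by simp
  note range = reflect_range[OF p pn, of _ a]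
  have succ: "{?\<sigma> y, ?\<sigma> (y + 1)} \<in> edges (BF p q)" if y: "y \<in> {1..n}" "y + 1 \<in> {1..n}" for y
  proof (cases "a = 1 \<and> y < p \<or> a \<noteq> 1 \<and> a = n \<and> p \<le> y")
    case True
    then consider "a = 1" "y + 1 < p" | "a = 1" "y + 1 = p" | "a \<noteq> 1" "a = n" "p < y"
      | "a \<noteq> 1" "a = n" "y = p"
      by linarith
    then have "?\<sigma> y = ?\<sigma> (y + 1) + 1 \<or> ?\<sigma> y = 1 \<and> ?\<sigma> (y + 1) = p \<or>
        ?\<sigma> y = p \<and> ?\<sigma> (y + 1) = n"
    proof cases
      case 1
      then have "?\<sigma> y = ?\<sigma> (y + 1) + 1" by (simp add: reflect_def Suc_diff_Suc)
      then show ?thesis ..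
    next
      case 2
      then have "?\<sigma> y = 1" "?\<sigma> (y + 1) = p" by (auto simp: reflect_def)
      then show ?thesis by simp
    next
      case 3
      then have "?\<sigma> y = ?\<sigma> (y + 1) + 1" using y by (simp add: reflect_def Suc_diff_le)
      then show ?thesis ..
    next
      case 4
      then have "?\<sigma> y = p" "?\<sigma> (y + 1) = n" by (auto simp: reflect_def)
      then show ?thesis by simp
    qed
    then show ?thesis using range y unfolding BF_edge_iff[OF n p q] by blast
  next
    case False
    then have "?\<sigma> y = y" "?\<sigma> (y + 1) = y + 1" using pn by (auto simp: reflect_def)
    then show ?thesis using y unfolding BF_edge_iff[OF n p q] by simp
  qed
  have "?\<sigma> p = p" "?\<sigma> 1 = 1 \<or> ?\<sigma> 1 + 1 = p" "?\<sigma> n = n \<or> ?\<sigma> n = p + 1"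
    using p pn by (auto simp: reflect_def)
  moreover have "p \<in> {1..n}" "?\<sigma> 1 \<in> {1..n}" "?\<sigma> n \<in> {1..n}"
    using p pn range[of 1] range[of n] by auto
  ultimately have closing: "{?\<sigma> 1, ?\<sigma> p} \<in> edges (BF p q)" "{?\<sigma> n, ?\<sigma> p} \<in> edges (BF p q)"
    unfolding BF_edge_iff[OF n p q] by auto
  have "y \<in> {1..n}" "y' \<in> {1..n}"
    "y' = y + 1 \<or> y = y' + 1 \<or> y = 1 \<and> y' = p \<or> y = p \<and> y' = 1 \<or> y = n \<and> y' = p \<or> y = p \<and> y' = n"
    using edge unfolding BF_edge_iff[OF n p q] by blast+
  then show ?thesis
    using succ[of y] succ[of y'] closing by (elim disjE conjE) (simp_all add: insert_commute)
qed

text \<open>An automorphism of the factor, applied to both coordinates, preserves both kinds of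
  edges. For swap edges this takes injectivity, which follows from the involution.\<close>

lemma reflect_OTIS_edge:
  assumes n: "n = p + q - 1" and p: "3 \<le> p" and q: "3 \<le> q" and a: "a \<in> {1..n}"
    and edge: "{(x, y), (x', y')} \<in> edges (OTIS (BF p q))"
  shows "{(reflect p n a x, reflect p n a y), (reflect p n a x', reflect p n a y')}
    \<in> edges (OTIS (BF p q))"
proof -
  have pn: "p + 2 \<le> n" using n q by simp
  have verts: "verts (BF p q) = {1..n}" by (simp add: BF_def n)
  have "reflect p n a x \<noteq> reflect p n a y" if "x \<noteq> y" "x \<in> {1..n}" "y \<in> {1..n}"
    using that reflect_reflect[OF p pn] by metis
  then show ?thesis
    using edge reflect_range[OF p pn, of _ a] reflect_BF_edge[OF n p q a]
    unfolding OTIS_edge_iff verts by blast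
qed

section \<open>Running programs\<close>

primrec loop_free :: "com \<Rightarrow> bool" where
  "loop_free Skip \<longleftrightarrow> True"
| "loop_free (Assign x e) \<longleftrightarrow> True"
| "loop_free (Store k i e) \<longleftrightarrow> True"
| "loop_free (Seq c1 c2) \<longleftrightarrow> loop_free c1 \<and> loop_free c2"
| "loop_free (Cond b c1 c2) \<longleftrightarrow> loop_free c1 \<and> loop_free c2"
| "loop_free (While b c) \<longleftrightarrow> False"

text \<open>At \<open>While\<close> this function and \<open>max_cost\<close> have dummy values;
  both are applied to loop-free programs.\<close>

primrec result :: "com \<Rightarrow> store \<Rightarrow> store" where
  "result Skip s = s"
| "result (Assign x e) s = s\<lparr>reg := (reg s)(x := aval e s)\<rparr>"
| "result (Store k i e) s = s\<lparr>arr := (arr s)(k := (arr s k)(aval i s := aval e s))\<rparr>"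
| "result (Seq c1 c2) s = result c2 (result c1 s)"
| "result (Cond b c1 c2) s = (if bval b s then result c1 s else result c2 s)"
| "result (While b c) s = s"

primrec max_cost :: "com \<Rightarrow> nat" where
  "max_cost Skip = 1"
| "max_cost (Assign x e) = acost e + 1"
| "max_cost (Store k i e) = acost i + acost e + 1"
| "max_cost (Seq c1 c2) = max_cost c1 + max_cost c2"
| "max_cost (Cond b c1 c2) = bcost b + max (max_cost c1) (max_cost c2) + 1"
| "max_cost (While b c) = 0"

lemma exec_loop_free:
  "loop_free c \<Longrightarrow> \<exists>t \<le> max_cost c. exec c s t (result c s)"
proof (induction c arbitrary: s)
  case (Seq c1 c2)
  obtain t1 where t1: "t1 \<le> max_cost c1" "exec c1 s t1 (result c1 s)"
    using Seq by auto
  obtain t2 where "t2 \<le> max_cost c2" "exec c2 (result c1 s) t2 (result c2 (result c1 s))"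
    using Seq by (metis loop_free.simps(4))
  then have "exec (Seq c1 c2) s (t1 + t2) (result (Seq c1 c2) s)"
    "t1 + t2 \<le> max_cost (Seq c1 c2)"
    using t1 by (auto intro: exec.Seq)
  then show ?case by blast
next
  case (Cond b c1 c2)
  show ?case
  proof (cases "bval b s")
    case True
    obtain t where "t \<le> max_cost c1" "exec c1 s t (result c1 s)" using Cond by auto
    then have "exec (Cond b c1 c2) s (bcost b + t + 1) (result (Cond b c1 c2) s)"
      "bcost b + t + 1 \<le> max_cost (Cond b c1 c2)"
      using exec.CondTrue[OF True] True by auto
    then show ?thesis by blast
  next
    case False
    obtain t where "t \<le> max_cost c2" "exec c2 s t (result c2 s)" using Cond by auto
    then have "exec (Cond b c1 c2) s (bcost b + t + 1) (result (Cond b c1 c2) s)"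
      "bcost b + t + 1 \<le> max_cost (Cond b c1 c2)"
      using exec.CondFalse[OF False] False by auto
    then show ?thesis by blast
  qed
next
  case Skip
  show ?case using exec.Skip[of s] by (intro exI[of _ 1]) simp
next
  case (Assign x e)
  show ?case using exec.Assign[of x e s] by (intro exI[of _ "acost e + 1"]) simp
next
  case (Store k i e)
  show ?case using exec.Store[of k i e s] by (intro exI[of _ "acost i + acost e + 1"]) simp
qed simp

text \<open>Total correctness with a time bound; as \<open>exec\<close> is deterministic, the run
  asked for is the only one.\<close>

definition terminates :: "com \<Rightarrow> store \<Rightarrow> nat \<Rightarrow> (store \<Rightarrow> bool) \<Rightarrow> bool" where
  "terminates c s T Q \<longleftrightarrow> (\<exists>t s'. exec c s t s' \<and> t \<le> T \<and> Q s')"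

lemma terminates_loop_free:
  assumes "loop_free c" "max_cost c \<le> T" "Q (result c s)"
  shows "terminates c s T Q"
  using assms exec_loop_free[of c s] unfolding terminates_def by (meson order_trans)

lemma terminates_Seq:
  assumes "terminates c1 s T1 P" "\<And>s'. P s' \<Longrightarrow> terminates c2 s' T2 Q"
  shows "terminates (Seq c1 c2) s (T1 + T2) Q"
  using assms unfolding terminates_def by (meson add_mono exec.Seq)

lemma terminates_mono:
  assumes "terminates c s T P" "T \<le> T'" "\<And>s'. P s' \<Longrightarrow> Q s'"
  shows "terminates c s T' Q"
  using assms unfolding terminates_def by (meson order_trans)

text \<open>Each round pays for the test, at most \<open>T\<close> for the body, and one unit more;
  the failing last test accounts for the final summand.\<close>

lemma terminates_counted_loop:
  assumes "I 0 s"
    and step: "\<And>i s. i < N \<Longrightarrow> I i s \<Longrightarrow> bval b s \<and> terminates c s T (I (Suc i))"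
    and exit: "\<And>s. I N s \<Longrightarrow> \<not> bval b s"
  shows "terminates (While b c) s (N * (bcost b + T + 1) + (bcost b + 1)) (I N)"
proof -
  \<comment> \<open>Induction on the number \<open>k\<close> of rounds still to run, hence the
    invariant at \<open>N - k\<close>.\<close>
  have "terminates (While b c) s (k * (bcost b + T + 1) + (bcost b + 1)) (I N)"
    if "k \<le> N" "I (N - k) s" for k s
    using that
  proof (induction k arbitrary: s)
    case 0
    then have "\<not> bval b s" using exit by simp
    then show ?case
      using 0 exec.WhileFalse[of b s c] by (auto simp: terminates_def)
  next
    case (Suc k)
    have *: "bval b s" "terminates c s T (I (Suc (N - Suc k)))"
      using step[of "N - Suc k" s] Suc.prems by auto
    moreover have "Suc (N - Suc k) = N - k" using Suc.prems by simp
    ultimately obtain t1 s1 where 1: "exec c s t1 s1" "t1 \<le> T" "I (N - k) s1"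
      by (auto simp: terminates_def)
    obtain t2 s2 where 2: "exec (While b c) s1 t2 s2" "I N s2"
      "t2 \<le> k * (bcost b + T + 1) + (bcost b + 1)"
      using Suc.IH[of s1] Suc.prems 1 by (auto simp: terminates_def)
    have "exec (While b c) s (bcost b + t1 + t2 + 1) s2"
      using *(1) 1(1) 2(1) by (rule exec.WhileTrue)
    moreover have "bcost b + t1 + t2 + 1 \<le> Suc k * (bcost b + T + 1) + (bcost b + 1)"
      using 1(2) 2(3) by simp
    ultimately show ?case using 2(2) unfolding terminates_def by blast
  qed
  from this[of N s] show ?thesis using assms(1) by simp
qed


section \<open>The program\<close>

text \<open>Registers: 0 \<open>p\<close>, 5 \<open>n\<close>, 6 table index, 7 relabelled root group, 8 and 9 current vertex
  in the new labels, 10 its output index. Arrays: 6 multiples of \<open>n\<close>, 7 the relabelling.\<close>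

definition emit :: "aexp \<times> aexp \<times> aexp \<times> aexp \<Rightarrow> com" where
  "emit = (\<lambda>(e1, e2, e3, e4).
     Seq (Store 2 (Reg 10) (Elem 7 e1)) (Seq (Store 3 (Reg 10) (Elem 7 e2))
       (Seq (Store 4 (Reg 10) (Elem 7 e3)) (Store 5 (Reg 10) (Elem 7 e4)))))"

primrec compile :: "(bexp \<times> aexp \<times> aexp \<times> aexp \<times> aexp) list \<Rightarrow> com" where
  "compile [] = Skip"
| "compile (r # rs) = Cond (fst r) (emit (snd r)) (compile rs)"

text \<open>What the first rule with a true test denotes. The last test of \<open>rules\<close>
  always holds, so the default \<open>undefined\<close> is not reached there.\<close>

primrec decide :: "(bexp \<times> aexp \<times> aexp \<times> aexp \<times> aexp) list \<Rightarrow> store \<Rightarrow>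
    (nat \<times> nat) \<times> (nat \<times> nat)" where
  "decide [] s = undefined"
| "decide (r # rs) s = (if bval (fst r) s then (case snd r of (e1, e2, e3, e4) \<Rightarrow>
     ((aval e1 s, aval e2 s), (aval e3 s, aval e4 s))) else decide rs s)"

text \<open>\<open>emit\<close> evaluates three of its expressions after it has begun to store;
  without array accesses these keep their values.\<close>

primrec array_free :: "aexp \<Rightarrow> bool" where
  "array_free (Const k) \<longleftrightarrow> True"
| "array_free (Reg x) \<longleftrightarrow> True"
| "array_free (Elem k e) \<longleftrightarrow> False"
| "array_free (Add e1 e2) \<longleftrightarrow> array_free e1 \<and> array_free e2"
| "array_free (Sub e1 e2) \<longleftrightarrow> array_free e1 \<and> array_free e2"

lemma aval_array_free: "array_free e \<Longrightarrow> aval e (s\<lparr>arr := A\<rparr>) = aval e s"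
  by (induction e) auto

text \<open>Array 7 translates the parents from the new labels back to the original ones; as
  \<open>reflect\<close> is an involution, one table serves both directions.\<close>

definition write_parents :: "(nat \<Rightarrow> nat \<Rightarrow> nat) \<Rightarrow> nat \<Rightarrow> (nat \<times> nat) \<times> (nat \<times> nat) \<Rightarrow>
    nat \<Rightarrow> nat \<Rightarrow> nat" where
  "write_parents A k = (\<lambda>((u1, v1), (u2, v2)).
     A(2 := (A 2)(k := A 7 u1), 3 := (A 3)(k := A 7 v1),
       4 := (A 4)(k := A 7 u2), 5 := (A 5)(k := A 7 v2)))"

lemma result_emit:
  assumes "array_free e1" "array_free e2" "array_free e3" "array_free e4"
  shows "result (emit (e1, e2, e3, e4)) s = s\<lparr>arr := write_parents (arr s) (reg s 10)
    ((aval e1 s, aval e2 s), (aval e3 s, aval e4 s))\<rparr>"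
  using assms by (simp add: emit_def write_parents_def aval_array_free)

lemma loop_free_compile: "loop_free (compile rs)"
  by (induction rs) (auto simp: emit_def split: prod.split)

lemma result_compile:
  assumes "\<forall>(b, e1, e2, e3, e4) \<in> set rs.
      array_free e1 \<and> array_free e2 \<and> array_free e3 \<and> array_free e4"
    and "\<exists>r \<in> set rs. bval (fst r) s"
  shows "result (compile rs) s = s\<lparr>arr := write_parents (arr s) (reg s 10) (decide rs s)\<rparr>"
  using assms
proof (induction rs)
  case (Cons r rs)
  obtain b e1 e2 e3 e4 where r: "r = (b, e1, e2, e3, e4)" by (metis prod.exhaust)
  show ?case
  proof (cases "bval b s")
    case True
    then show ?thesis using Cons.prems(1) by (simp add: r result_emit)
  next
    case False
    then show ?thesis using Cons by (simp add: r)
  qed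
qed simp

text \<open>A transcription of \<open>parents\<close>, branch by branch; the true last test stands
  for its final \<open>else\<close>.\<close>

definition rules :: "(bexp \<times> aexp \<times> aexp \<times> aexp \<times> aexp) list" where
  "rules =
    (let p = Reg 0; n = Reg 5; a = Reg 7; x = Reg 8; y = Reg 9; one = Const 1; two = Const 2;
         x_first = Equal x one; y_first = Equal y one; x_last = Equal x n; y_last = Equal y n;
         succ = Add y one; pred = Sub y one
     in [(Both x_first (Both y_first (Equal a two)), one, p, one, two),
         (Both x_first y_first, one, two, one, p),
         (Both x_first (Less y a), y, one, one, succ),
         (Both x_first (Equal y a), one, succ, y, one),
         (Both x_first (Less y n), one, succ, one, pred),
         (x_first, n, one, one, Sub n one),
         (Both x_last (Both y_last (Equal (Add a one) n)), n, Sub n one, n, p),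
         (Both x_last y_last, n, p, n, Sub n one),
         (Both x_last (Less a y), n, pred, y, n),
         (Both x_last (Equal y a), y, n, n, pred),
         (Both x_last (Less one y), n, succ, n, pred),
         (x_last, n, two, one, n),
         (Both (Equal x a) y_first, one, x, x, two),
         (Both (Equal x a) (Less y n), x, pred, x, succ),
         (Equal x a, x, Sub n one, n, x),
         (y_first, x, two, one, x),
         (Less y n, x, succ, x, pred),
         (Equal one one, n, x, x, Sub n one)])"

lemma decide_rules:
  "decide rules s = parents (reg s 0) (reg s 5) (reg s 7) (reg s 8) (reg s 9)"
  unfolding rules_def parents_def Let_def by simp

lemma result_compile_rules:
  "result (compile rules) s = s\<lparr>arr := write_parents (arr s) (reg s 10)
     (parents (reg s 0) (reg s 5) (reg s 7) (reg s 8) (reg s 9))\<rparr>"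
  unfolding decide_rules[symmetric]
  by (rule result_compile) (simp_all add: rules_def Let_def)

text \<open>The machine cannot multiply: each multiple of \<open>n\<close> is the preceding one plus
  \<open>n\<close>, starting from the initial 0 in cell 0.\<close>

definition table_body :: com where
  "table_body =
    Seq (Store 6 (Reg 6) (Add (Elem 6 (Sub (Reg 6) (Const 1))) (Reg 5)))
      (Seq (Cond (Both (Equal (Reg 2) (Const 1)) (Less (Reg 6) (Reg 0)))
             (Store 7 (Reg 6) (Sub (Reg 0) (Reg 6)))
             (Cond (Both (Equal (Reg 2) (Reg 5)) (Less (Reg 0) (Reg 6)))
               (Store 7 (Reg 6) (Sub (Add (Add (Reg 5) (Reg 0)) (Const 1)) (Reg 6)))
               (Store 7 (Reg 6) (Reg 6))))
        (Assign 6 (Add (Reg 6) (Const 1))))"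

definition vertex_body :: com where
  "vertex_body =
    Seq (Assign 10 (Add (Elem 6 (Elem 7 (Reg 8))) (Elem 7 (Reg 9))))
      (Seq (compile rules) (Assign 9 (Add (Reg 9) (Const 1))))"

definition vertex_loop :: com where
  "vertex_loop = While (Less (Reg 9) (Add (Reg 5) (Const 1))) vertex_body"

definition group_body :: com where
  "group_body = Seq (Assign 9 (Const 1)) (Seq vertex_loop (Assign 8 (Add (Reg 8) (Const 1))))"

definition table_init :: com where
  "table_init = Seq (Assign 5 (Sub (Add (Reg 0) (Reg 1)) (Const 1))) (Assign 6 (Const 1))"

definition table_loop :: com where
  "table_loop = While (Less (Reg 6) (Add (Reg 5) (Const 1))) table_body"

definition group_init :: com where
  "group_init = Seq (Assign 7 (Elem 7 (Reg 2))) (Assign 8 (Const 1))"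

definition group_loop :: com where
  "group_loop = While (Less (Reg 8) (Add (Reg 5) (Const 1))) group_body"

definition program :: com where
  "program = Seq table_init (Seq table_loop (Seq group_init group_loop))"

section \<open>Invariants and time bounds of the two nested loops\<close>

definition entry :: "nat \<Rightarrow> nat \<Rightarrow> nat \<Rightarrow> (nat \<Rightarrow> nat \<Rightarrow> nat) \<Rightarrow> nat \<Rightarrow> nat \<Rightarrow> bool" where
  "entry p n a A x y \<longleftrightarrow>
    (let \<tau> = A 7; k = A 6 (\<tau> x) + \<tau> y; P = parents p n a x y
     in (A 2 k, A 3 k) = map_prod \<tau> \<tau> (fst P) \<and>
        (A 4 k, A 5 k) = map_prod \<tau> \<tau> (snd P))"

text \<open>\<open>R\<close> stands for the multiples of \<open>n\<close> and \<open>\<tau>\<close>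
  for the relabelling. The loops rely on one fact about them: different vertices have different
  output cells.\<close>

locale tables =
  fixes p n a :: nat and R \<tau> :: "nat \<Rightarrow> nat"
  assumes index_inj: "\<And>x y x' y'. \<lbrakk>x \<in> {1..n}; y \<in> {1..n}; x' \<in> {1..n}; y' \<in> {1..n};
    R (\<tau> x) + \<tau> y = R (\<tau> x') + \<tau> y'\<rbrakk> \<Longrightarrow> x = x' \<and> y = y'"
begin

definition ready :: "store \<Rightarrow> bool" where
  "ready s \<longleftrightarrow> reg s 0 = p \<and> reg s 5 = n \<and> reg s 7 = a \<and> arr s 6 = R \<and> arr s 7 = \<tau>"

definition done_before :: "nat \<Rightarrow> nat \<Rightarrow> (nat \<Rightarrow> nat \<Rightarrow> nat) \<Rightarrow> bool" where
  "done_before x y A \<longleftrightarrow> (\<forall>x' \<in> {1..n}. \<forall>y' \<in> {1..n}.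
     x' < x \<or> x' = x \<and> y' < y \<longrightarrow> entry p n a A x' y')"

text \<open>\<open>k\<close> counts finished vertices from 0, as in
  \<open>terminates_counted_loop\<close>, while labels start at 1; hence
  \<open>Suc k\<close>.\<close>

definition vertex_inv :: "nat \<Rightarrow> nat \<Rightarrow> store \<Rightarrow> bool" where
  "vertex_inv x k s \<longleftrightarrow> ready s \<and> reg s 8 = x \<and> reg s 9 = Suc k \<and> done_before x (Suc k) (arr s)"

lemma done_before_next_group: "done_before x (Suc n) A \<Longrightarrow> done_before (Suc x) 1 A"
  by (auto simp: done_before_def less_Suc_eq_le[of _ n] less_Suc_eq[of _ x])

lemma vertex_inv_step:
  assumes "vertex_inv x k s" "x \<in> {1..n}" "k < n"
  shows "vertex_inv x (Suc k) (result vertex_body s)"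
proof -
  let ?s = "result vertex_body s" and ?k = "R (\<tau> x) + \<tau> (Suc k)"
  have r: "ready s" "reg s 8 = x" "reg s 9 = Suc k" and old: "done_before x (Suc k) (arr s)"
    using assms(1) by (auto simp: vertex_inv_def)
  have arr: "arr ?s = write_parents (arr s) ?k (parents p n a x (Suc k))"
    and reg: "reg ?s = (reg s)(10 := ?k, 9 := Suc (Suc k))"
    using r by (auto simp: vertex_body_def result_compile_rules ready_def)
  have "entry p n a (arr ?s) x' y'"
    if "x' \<in> {1..n}" "y' \<in> {1..n}" "x' < x \<or> x' = x \<and> y' < Suc (Suc k)" for x' y'
  proof (cases "x' = x \<and> y' = Suc k")
    case True
    then show ?thesis
      using r by (simp add: entry_def arr write_parents_def ready_def Let_def split: prod.split)
  next
    case False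
    then have "entry p n a (arr s) x' y'" using old that by (auto simp: done_before_def)
    \<comment> \<open>By injectivity the new entry does not overwrite an older one.\<close>
    moreover have "R (\<tau> x') + \<tau> y' \<noteq> ?k"
      using index_inj[of x' y' x "Suc k"] that False assms by auto
    ultimately show ?thesis
      using r by (simp add: entry_def arr write_parents_def ready_def Let_def split: prod.splits)
  qed
  then have "done_before x (Suc (Suc k)) (arr ?s)" by (simp add: done_before_def)
  moreover have "ready ?s"
    using r(1) by (simp add: ready_def arr reg write_parents_def split: prod.split)
  ultimately show ?thesis using r by (simp add: vertex_inv_def reg)
qed

lemma loop_free_vertex_body: "loop_free vertex_body"
  by (simp add: vertex_body_def loop_free_compile)

text \<open>The test of the loop costs 5, which makes 6 per round besides the body and 6 for the
  exit.\<close>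

lemma vertex_loop:
  assumes "vertex_inv x 0 s" "x \<in> {1..n}"
  shows "terminates vertex_loop s (n * (max_cost vertex_body + 6) + 6) (vertex_inv x n)"
proof -
  let ?b = "Less (Reg 9) (Add (Reg 5) (Const 1))"
  have "terminates vertex_loop s (n * (bcost ?b + max_cost vertex_body + 1) + (bcost ?b + 1))
      (vertex_inv x n)"
    unfolding vertex_loop_def
  proof (rule terminates_counted_loop[where I = "vertex_inv x"])
    fix k s assume "k < n" "vertex_inv x k s"
    then show "bval ?b s \<and> terminates vertex_body s (max_cost vertex_body) (vertex_inv x (Suc k))"
      using vertex_inv_step[of x k s] assms(2) terminates_loop_free[OF loop_free_vertex_body order_refl]
      by (simp add: vertex_inv_def ready_def)
  qed (use assms in \<open>auto simp: vertex_inv_def ready_def\<close>)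
  then show ?thesis by (rule terminates_mono) (simp_all add: algebra_simps)
qed

definition group_inv :: "nat \<Rightarrow> store \<Rightarrow> bool" where
  "group_inv k s \<longleftrightarrow> ready s \<and> reg s 8 = Suc k \<and> done_before (Suc k) 1 (arr s)"

lemma group_body:
  assumes "group_inv k s" "k < n"
  shows "terminates group_body s (2 + (n * (max_cost vertex_body + 6) + 6 + 4)) (group_inv (Suc k))"
  unfolding group_body_def
proof (rule terminates_Seq)
  show "terminates (Assign 9 (Const 1)) s 2 (vertex_inv (Suc k) 0)"
    using assms by (intro terminates_loop_free)
      (auto simp: group_inv_def vertex_inv_def ready_def)
  show "terminates (Seq vertex_loop (Assign 8 (Add (Reg 8) (Const 1)))) s'
      (n * (max_cost vertex_body + 6) + 6 + 4) (group_inv (Suc k))"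
    if "vertex_inv (Suc k) 0 s'" for s'
  proof (rule terminates_Seq)
    show "terminates vertex_loop s' (n * (max_cost vertex_body + 6) + 6) (vertex_inv (Suc k) n)"
      using vertex_loop that assms(2) by simp
    show "terminates (Assign 8 (Add (Reg 8) (Const 1))) s'' 4 (group_inv (Suc k))"
      if "vertex_inv (Suc k) n s''" for s''
      using that done_before_next_group[of "Suc k" "arr s''"] by (intro terminates_loop_free)
        (simp_all add: group_inv_def vertex_inv_def ready_def)
  qed
qed

text \<open>The 18 consists of 2 and 4 for the two assignments in the body, 6 for the exit of the
  inner loop and 6 for the round itself.\<close>

lemma group_loop:
  assumes "group_inv 0 s"
  shows "terminates group_loop s (n * (n * (max_cost vertex_body + 6) + 18) + 6) (group_inv n)"
proof -
  let ?b = "Less (Reg 8) (Add (Reg 5) (Const 1))"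
  have "terminates group_loop s
      (n * (bcost ?b + (2 + (n * (max_cost vertex_body + 6) + 6 + 4)) + 1) + (bcost ?b + 1))
      (group_inv n)"
    unfolding group_loop_def
  proof (rule terminates_counted_loop[where I = group_inv])
    fix k s assume "k < n" "group_inv k s"
    then show "bval ?b s \<and> terminates group_body s
        (2 + (n * (max_cost vertex_body + 6) + 6 + 4)) (group_inv (Suc k))"
      using group_body by (simp add: group_inv_def ready_def)
  qed (use assms in \<open>auto simp: group_inv_def ready_def\<close>)
  then show ?thesis by (rule terminates_mono) (simp_all add: algebra_simps)
qed

end

section \<open>Filling the two tables\<close>

definition table_inv :: "nat \<Rightarrow> nat \<Rightarrow> nat \<Rightarrow> nat \<Rightarrow> store \<Rightarrow> bool" where
  "table_inv p n a k s \<longleftrightarrow> reg s 0 = p \<and> reg s 5 = n \<and> reg s 2 = a \<and> reg s 6 = Suc k \<and>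
     (\<forall>i \<le> k. arr s 6 i = i * n) \<and> (\<forall>i \<in> {1..k}. arr s 7 i = reflect p n a i)"

lemma table_inv_step:
  assumes "table_inv p n a k s"
  shows "table_inv p n a (Suc k) (result table_body s)"
  using assms unfolding table_inv_def table_body_def
  by (auto simp: reflect_def le_Suc_eq)

lemma table_loop:
  assumes "table_inv p n a 0 s"
  shows "terminates table_loop s (n * (max_cost table_body + 6) + 6) (table_inv p n a n)"
proof -
  let ?b = "Less (Reg 6) (Add (Reg 5) (Const 1))"
  have lf: "loop_free table_body" by (simp add: table_body_def)
  have "terminates table_loop s (n * (bcost ?b + max_cost table_body + 1) + (bcost ?b + 1))
      (table_inv p n a n)"
    unfolding table_loop_def
  proof (rule terminates_counted_loop[where I = "table_inv p n a"])
    fix k s assume "k < n" "table_inv p n a k s"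
    then show "bval ?b s \<and> terminates table_body s (max_cost table_body) (table_inv p n a (Suc k))"
      using table_inv_step[of p n a k s] terminates_loop_free[OF lf order_refl]
      by (simp add: table_inv_def)
  qed (use assms in \<open>auto simp: table_inv_def\<close>)
  then show ?thesis by (rule terminates_mono) (simp_all add: algebra_simps)
qed

text \<open>\<open>u\<close> and \<open>v - 1\<close> are the quotient and the remainder of the
  index minus 1 by \<open>n\<close>.\<close>

lemma index_inj:
  fixes u v u' v' n :: nat
  assumes "u * n + v = u' * n + v'" "v \<in> {1..n}" "v' \<in> {1..n}"
  shows "u = u' \<and> v = v'"
proof -
  have *: "(u * n + v - 1) div n = u \<and> (u * n + v - 1) mod n = v - 1" if "v \<in> {1..n}" for u v
  proof -
    have "u * n + v - 1 = (v - 1) + u * n" "v - 1 < n" using that by auto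
    then show ?thesis by simp
  qed
  then show ?thesis using *[OF assms(2), of u] *[OF assms(3), of u'] assms by auto
qed

text \<open>The 42 collects the constants of the loops: 6 + 6 from the tables, 6 + 18 + 6 from the
  groups and vertices.\<close>

definition cost_factor :: nat where
  "cost_factor = max_cost vertex_body + max_cost table_body + max_cost table_init
     + max_cost group_init + 42"

text \<open>The premise keeps the look-ups in array 7 within the tabulated range; for vertices other
  than the root \<open>parents_closed\<close> supplies it.\<close>

definition program_output :: "nat \<Rightarrow> nat \<Rightarrow> nat \<Rightarrow> store \<Rightarrow> bool" where
  "program_output p n a s \<longleftrightarrow> (\<forall>x \<in> {1..n}. \<forall>y \<in> {1..n}.
     let \<sigma> = reflect p n a; k = \<sigma> x * n + \<sigma> y; P = parents p n (\<sigma> a) x y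
     in fst P \<in> {1..n} \<times> {1..n} \<and> snd P \<in> {1..n} \<times> {1..n} \<longrightarrow>
        (arr s 2 k, arr s 3 k) = map_prod \<sigma> \<sigma> (fst P) \<and>
        (arr s 4 k, arr s 5 k) = map_prod \<sigma> \<sigma> (snd P))"

lemma program_correct:
  assumes p: "3 \<le> p" and n: "n = p + q - 1" and q: "3 \<le> q"
    and r: "r \<in> {1..n} \<times> {1..n}"
  shows "terminates program (input p q cs r) (cost_factor * (n * n)) (program_output p n (fst r))"
proof -
  define a where "a = fst r"
  have a: "a \<in> {1..n}" and pn: "p + 2 \<le> n" using r n q by (auto simp: a_def)
  have "terminates program (input p q cs r)
      (max_cost table_init + (n * (max_cost table_body + 6) + 6 +
        (max_cost group_init + (n * (n * (max_cost vertex_body + 6) + 18) + 6))))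
      (program_output p n a)"
    unfolding program_def
  proof (rule terminates_Seq)
    show "terminates table_init (input p q cs r) (max_cost table_init) (table_inv p n a 0)"
      by (rule terminates_loop_free)
        (auto simp: table_init_def table_inv_def input_def n a_def)
    show "terminates (Seq table_loop (Seq group_init group_loop)) s
        (n * (max_cost table_body + 6) + 6 +
          (max_cost group_init + (n * (n * (max_cost vertex_body + 6) + 18) + 6)))
        (program_output p n a)" if "table_inv p n a 0 s" for s
    proof (rule terminates_Seq)
      show "terminates table_loop s (n * (max_cost table_body + 6) + 6) (table_inv p n a n)"
        using table_loop that by simp
      show "terminates (Seq group_init group_loop) s
          (max_cost group_init + (n * (n * (max_cost vertex_body + 6) + 18) + 6))
          (program_output p n a)" if inv: "table_inv p n a n s" for s
      proof -
        let ?\<sigma> = "reflect p n a"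
        have R: "\<And>i. i \<in> {1..n} \<Longrightarrow> arr s 6 i = i * n"
          and \<tau>: "\<And>i. i \<in> {1..n} \<Longrightarrow> arr s 7 i = ?\<sigma> i"
          using inv by (auto simp: table_inv_def)
        note range = reflect_range[OF p pn]
        interpret tables p n "?\<sigma> a" "arr s 6" "arr s 7"
        proof
          fix x y x' y'
          assume xy: "x \<in> {1..n}" "y \<in> {1..n}" "x' \<in> {1..n}" "y' \<in> {1..n}"
            and eq: "arr s 6 (arr s 7 x) + arr s 7 y = arr s 6 (arr s 7 x') + arr s 7 y'"
          have "?\<sigma> x * n + ?\<sigma> y = ?\<sigma> x' * n + ?\<sigma> y'"
            using eq xy range by (simp add: R \<tau>)
          then have "?\<sigma> x = ?\<sigma> x' \<and> ?\<sigma> y = ?\<sigma> y'"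
            by (rule index_inj) (use range xy in auto)
          then show "x = x' \<and> y = y'"
            using xy reflect_reflect[OF p pn] by metis
        qed
        show ?thesis
        proof (rule terminates_Seq)
          show "terminates group_init s (max_cost group_init) (group_inv 0)"
            using inv a by (intro terminates_loop_free)
              (auto simp: group_init_def group_inv_def ready_def done_before_def table_inv_def \<tau>)
          show "terminates group_loop s' (n * (n * (max_cost vertex_body + 6) + 18) + 6)
              (program_output p n a)" if "group_inv 0 s'" for s'
            using group_loop[OF that]
          proof (rule terminates_mono)
            fix s'' assume inv: "group_inv n s''"
            show "program_output p n a s''"
              unfolding program_output_def Let_def
            proof (intro ballI impI)
              fix x y
              assume xy: "x \<in> {1..n}" "y \<in> {1..n}"
                and cl: "fst (parents p n (?\<sigma> a) x y) \<in> {1..n} \<times> {1..n} \<and>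
                  snd (parents p n (?\<sigma> a) x y) \<in> {1..n} \<times> {1..n}"
              have "entry p n (?\<sigma> a) (arr s'') x y"
                using inv xy by (auto simp: group_inv_def done_before_def)
              moreover have "arr s'' 6 = arr s 6" "arr s'' 7 = arr s 7"
                using inv by (auto simp: group_inv_def ready_def)
              ultimately show "(arr s'' 2 (?\<sigma> x * n + ?\<sigma> y), arr s'' 3 (?\<sigma> x * n + ?\<sigma> y))
                  = map_prod ?\<sigma> ?\<sigma> (fst (parents p n (?\<sigma> a) x y)) \<and>
                  (arr s'' 4 (?\<sigma> x * n + ?\<sigma> y), arr s'' 5 (?\<sigma> x * n + ?\<sigma> y))
                  = map_prod ?\<sigma> ?\<sigma> (snd (parents p n (?\<sigma> a) x y))"
                using xy cl range[OF xy(1)]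
                by (auto simp: entry_def Let_def R \<tau> map_prod_def split: prod.splits)
            qed
          qed simp
        qed
      qed
    qed
  qed
  then show ?thesis
  proof (rule terminates_mono)
    have n1: "1 \<le> n" using pn by simp
    \<comment> \<open>Since \<open>n\<close> is positive, constant and linear terms are absorbed
      into \<open>n * n\<close>.\<close>
    have le: "k \<le> k * (n * n)" "n * k \<le> k * (n * n)" for k
      using n1 by (simp_all add: mult.commute)
    have "n * (n * (max_cost vertex_body + 6) + 18) \<le>
        (max_cost vertex_body + 6) * (n * n) + 18 * (n * n)"
      using le(2)[of 18] by (simp add: algebra_simps)
    then have "max_cost table_init + (n * (max_cost table_body + 6) + 6 +
        (max_cost group_init + (n * (n * (max_cost vertex_body + 6) + 18) + 6)))
      \<le> max_cost table_init * (n * n) + ((max_cost table_body + 6) * (n * n) + 6 * (n * n) +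
        (max_cost group_init * (n * n) +
          ((max_cost vertex_body + 6) * (n * n) + 18 * (n * n) + 6 * (n * n))))"
      using le by (intro add_mono) blast+
    also have "\<dots> = cost_factor * (n * n)"
      by (simp add: cost_factor_def algebra_simps)
    finally show "max_cost table_init + (n * (max_cost table_body + 6) + 6 +
        (max_cost group_init + (n * (n * (max_cost vertex_body + 6) + 18) + 6)))
        \<le> cost_factor * (n * n)" .
  qed (simp add: a_def)
qed

section \<open>From the output arrays to independent trees\<close>

lemma output_tree_eq_parent_tree:
  "output_tree s i j n V r =
    parent_tree V r (\<lambda>(u, v). (arr s i (u * n + v), arr s j (u * n + v)))"
  by (auto simp: output_tree_def parent_tree_def)

text \<open>\<open>reflect\<close> carries each vertex into the labelling whose root group lies
  strictly between 1 and \<open>n\<close>. Its rank is taken there, and its parents are found there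
  and carried back.\<close>

lemma constructs_trees_if_program_output:
  assumes n: "n = p + q - 1" and p: "3 \<le> p" and q: "3 \<le> q" and r: "r \<in> {1..n} \<times> {1..n}"
    and out: "program_output p n (fst r) s"
  shows "constructs_trees s (add_edges (BF p q) F) r"
proof -
  obtain a b where ab: "r = (a, b)" "a \<in> {1..n}" "b \<in> {1..n}" using r by auto
  have pn: "p + 2 \<le> n" using n q by simp
  interpret butterfly p q n using n p q by unfold_locales
  let ?\<sigma> = "reflect p n a" and ?V = "{1..n} \<times> {1..n}"
  let ?G = "OTIS (add_edges (BF p q) F)"
  define f where "f = (\<lambda>(u, v). (arr s 2 (u * n + v), arr s 3 (u * n + v)))"
  define g where "g = (\<lambda>(u, v). (arr s 4 (u * n + v), arr s 5 (u * n + v)))"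
  note range = reflect_range[OF p pn, of _ a] and inv = reflect_reflect[OF p pn, of _ a]
  have verts: "verts ?G = ?V" and card: "card (verts (add_edges (BF p q) F)) = n"
    by (simp_all add: OTIS_def add_edges_def BF_def n)
  \<comment> \<open>The parents are joined by butterfly edges, and chords only add further
    edges.\<close>
  have sub: "edges (OTIS (BF p q)) \<subseteq> edges ?G"
    by (auto simp: OTIS_def add_edges_def)
  let ?rank = "\<lambda>v. rank n (?\<sigma> a) (?\<sigma> b) (map_prod ?\<sigma> ?\<sigma> v)"
  have *: "f v \<in> ?V \<and> {v, f v} \<in> edges ?G \<and> (f v = r \<or> ?rank (f v) < ?rank v) \<and>
      g v \<in> ?V \<and> {v, g v} \<in> edges ?G \<and> (g v = r \<or> ?rank v < ?rank (g v)) \<and> f v \<noteq> g v"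
    if v: "v \<in> ?V - {r}" for v
  proof -
    obtain u w where uw: "v = (u, w)" "u \<in> {1..n}" "w \<in> {1..n}" using v by auto
    define x y where "x = ?\<sigma> u" and "y = ?\<sigma> w"
    have xy: "x \<in> {1..n}" "y \<in> {1..n}" "?\<sigma> x = u" "?\<sigma> y = w"
      using uw range inv by (auto simp: x_def y_def)
    have nonroot: "(x, y) \<noteq> (?\<sigma> a, ?\<sigma> b)"
      using v uw ab inv by (metis Diff_iff insertI1 prod.inject xy(3,4))
    obtain x1 y1 x2 y2 where P: "parents p n (?\<sigma> a) x y = ((x1, y1), (x2, y2))"
      by (metis prod.exhaust)
    note hyps = reflect_root[OF p pn ab(2)] range[OF ab(3)] xy(1,2) nonroot
    have cl: "x1 \<in> {1..n}" "y1 \<in> {1..n}" "x2 \<in> {1..n}" "y2 \<in> {1..n}"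
      using parents_closed[OF hyps] by (auto simp: P)
    have fg: "f v = (?\<sigma> x1, ?\<sigma> y1)" "g v = (?\<sigma> x2, ?\<sigma> y2)"
      using out xy cl uw ab(1) unfolding program_output_def Let_def f_def g_def
      by (fastforce simp: P)+
    note fg' = fg[unfolded uw(1)]
    have e: "{v, f v} \<in> edges ?G" "{v, g v} \<in> edges ?G"
      using parents_adjacent[OF hyps] reflect_OTIS_edge[OF n p q ab(2), of x y] sub
      by (auto simp: P fg' uw(1) xy(3,4))
    have rank: "f v = r \<or> ?rank (f v) < ?rank v" "g v = r \<or> ?rank v < ?rank (g v)"
      using rank_fst_parents[OF hyps] rank_snd_parents[OF hyps] inv cl ab
      by (auto simp: P fg' uw(1) x_def[symmetric] y_def[symmetric])
    have "f v \<noteq> g v"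
      using parents_distinct[OF hyps] inv cl by (metis P fg fst_conv prod.inject snd_conv)
    then show ?thesis using e rank range cl by (simp add: fg)
  qed
  note trees = independent_trees_by_rank[where V = ?V and r = r and G = ?G and f = f and g = g
      and rank = ?rank]
  have "spanning_tree (parent_tree ?V r f) ?G \<and> spanning_tree (parent_tree ?V r g) ?G \<and>
      independent (parent_tree ?V r f) (parent_tree ?V r g) r"
    using * r verts by (intro conjI trees) blast+
  then show ?thesis
    unfolding constructs_trees_def Let_def card verts output_tree_eq_parent_tree f_def g_def
    by simp
qed

theorem mainTheorem7:
  shows "\<exists>(prog :: com) (K :: nat).
    \<forall>(p :: nat) (q :: nat) (F :: nat set set) (cs :: (nat \<times> nat) list) (B :: nat ugraph) (r :: nat \<times> nat).
      ((\<exists>m n. m \<ge> 1 \<and> n \<ge> 1 \<and> p = 2 * m + 1 \<and> q = 2 * n + 1) \<or>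
       (\<exists>m k. m \<ge> 1 \<and> k \<ge> 2 \<and> p = 2 * m + 1 \<and> q = 2 * k)) \<and>
      F \<subseteq> chords p q \<and> B = add_edges (BF p q) F \<and> (\<exists>v \<in> verts B. degree B v = 2) \<and>
      chord_list cs F \<and> r \<in> verts (OTIS B) \<longrightarrow>
      (\<exists>t s. exec prog (input p q cs r) t s \<and> t \<le> K * card (verts (OTIS B)) \<and>
             constructs_trees s B r)"
proof (rule exI[of _ program], rule exI[of _ cost_factor], intro allI impI, elim conjE)
  fix p q :: nat and F cs B and r :: "nat \<times> nat"
  assume pq: "(\<exists>m n. m \<ge> 1 \<and> n \<ge> 1 \<and> p = 2 * m + 1 \<and> q = 2 * n + 1) \<or>
       (\<exists>m k. m \<ge> 1 \<and> k \<ge> 2 \<and> p = 2 * m + 1 \<and> q = 2 * k)"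
    and B: "B = add_edges (BF p q) F" and r: "r \<in> verts (OTIS B)"
  define n where "n = p + q - 1"
  have p: "3 \<le> p" and q: "3 \<le> q" using pq by auto
  have verts: "verts (OTIS B) = {1..n} \<times> {1..n}"
    by (simp add: B OTIS_def add_edges_def BF_def n_def)
  have "terminates program (input p q cs r) (cost_factor * (n * n)) (program_output p n (fst r))"
    using program_correct[OF p n_def q] r verts by simp
  then obtain t s where "exec program (input p q cs r) t s" "t \<le> cost_factor * (n * n)"
    and out: "program_output p n (fst r) s"
    unfolding terminates_def by blast
  moreover have "constructs_trees s B r"
    using constructs_trees_if_program_output[OF n_def p q _ out] r verts unfolding B by simp
  \<comment> \<open>The bound quadratic in \<open>n\<close> is thus linear in the size of the
    network.\<close>
  moreover have "card (verts (OTIS B)) = n * n" by (simp add: verts card_cartesian_product)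
  ultimately show "\<exists>t s. exec program (input p q cs r) t s \<and>
      t \<le> cost_factor * card (verts (OTIS B)) \<and> constructs_trees s B r"
    by metis
qed

end
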